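(* Let $\Omega\subseteq\mathbb{R}^N$ be a bounded domain whose boundary $\partial\Omega$ is of class $C^2$ and which contains the origin in its interior. Let $\nu$ be the outer unit normal to $\partial\Omega$ and let $r=\sqrt{x_1^2+\dots+x_N^2}$. Suppose that for some constant $c$ there exists a function $u\in C^2(\overline{\Omega})$ satisfying $$\Delta u=-1\ \text{ in }\Omega,\qquad u=0\ \text{ on }\partial\Omega,\qquad \frac{\partial u}{\partial\nu}=-c\,r\ \text{ on }\partial\Omega.$$ Then $\Omega$ is an $N$-dimensional (Euclidean) ball.
   Context: A domain is a nonempty connected open set. $u\in C^2(\overline{\Omega})$ means that $u$ is twice continuously differentiable in $\Omega$ with all derivatives up to order $2$ extending continuously to $\overline{\Omega}$. $\frac{\partial u}{\partial\nu}=\nabla u\cdot\nu$ is the outer normal derivative on $\partial\Omega$. *)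

theory Defs
  imports "HOL-Analysis.Analysis"
begin

definition is_domain :: "'a::topological_space set \<Rightarrow> bool" where
  "is_domain S \<longleftrightarrow> open S \<and> connected S \<and> S \<noteq> {}"

definition partial :: "'n::finite \<Rightarrow> (real^'n \<Rightarrow> real) \<Rightarrow> real^'n \<Rightarrow> real" where
  "partial i f x = deriv (\<lambda>t. f (x + t *\<^sub>R axis i 1)) 0"

definition grad :: "(real^'n::finite \<Rightarrow> real) \<Rightarrow> real^'n \<Rightarrow> real^'n" where
  "grad f x = (\<chi> i. partial i f x)"

definition laplacian :: "(real^'n::finite \<Rightarrow> real) \<Rightarrow> real^'n \<Rightarrow> real" where
  "laplacian f x = (\<Sum>i\<in>UNIV. partial i (partial i f) x)"

text \<open>The class \<open>C\<^sup>2(S)\<close>; used for open \<open>S\<close> only.\<close>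

definition C2_on :: "(real^'n::finite) set \<Rightarrow> (real^'n \<Rightarrow> real) \<Rightarrow> bool" where
  "C2_on S f \<longleftrightarrow>
     f differentiable_on S \<and>
     (\<forall>i. partial i f differentiable_on S) \<and>
     (\<forall>i j. continuous_on S (partial j (partial i f)))"

definition extends_to_closure :: "'a::topological_space set \<Rightarrow> ('a \<Rightarrow> 'b::topological_space) \<Rightarrow> bool" where
  "extends_to_closure S f \<longleftrightarrow>
     (\<exists>g. continuous_on (closure S) g \<and> (\<forall>x\<in>S. g x = f x))"

text \<open>The class \<open>C\<^sup>2\<close> of the closure of the open set \<open>S\<close>. Only the values of \<open>f\<close> on the closure
  matter, and derivatives are taken at points of \<open>S\<close> only.\<close>

definition C2_on_closure :: "(real^'n::finite) set \<Rightarrow> (real^'n \<Rightarrow> real) \<Rightarrow> bool" where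
  "C2_on_closure S f \<longleftrightarrow>
     C2_on S f \<and>
     continuous_on (closure S) f \<and>
     (\<forall>i. extends_to_closure S (partial i f)) \<and>
     (\<forall>i j. extends_to_closure S (partial j (partial i f)))"

text \<open>Near each boundary point, and in suitable orthonormal coordinates, \<open>S\<close> is the region strictly
  above the graph of a \<open>C\<^sup>2\<close> function of \<open>N - 1\<close> variables. The unit vector \<open>e\<close> is the last
  coordinate direction; \<open>\<gamma>\<close> is evaluated only on the hyperplane orthogonal to \<open>e\<close>, and every \<open>C\<^sup>2\<close>
  function on that hyperplane is the restriction of a \<open>C\<^sup>2\<close> function on the whole space
  (compose with the orthogonal projection).\<close>

definition C2_boundary :: "(real^'n::finite) set \<Rightarrow> bool" where
  "C2_boundary S \<longleftrightarrow>
     (\<forall>p\<in>frontier S. \<exists>\<epsilon>>0. \<exists>e \<gamma>. norm e = 1 \<and> C2_on UNIV \<gamma> \<and>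
        S \<inter> ball p \<epsilon> = {x \<in> ball p \<epsilon>. x \<bullet> e > \<gamma> (x - (x \<bullet> e) *\<^sub>R e)})"

text \<open>A unit vector orthogonal to the tangent space of the boundary at \<open>p\<close> (the second conjunct: the
  component along \<open>n\<close> of \<open>y - p\<close> is of smaller order than its norm as \<open>y\<close> tends to \<open>p\<close> on the
  boundary) and pointing out of \<open>S\<close> (the third conjunct). For a \<open>C\<^sup>2\<close> boundary these conditions
  determine \<open>n\<close>. In dimension one the second conjunct is vacuous, as the boundary points are isolated.\<close>

definition outer_unit_normal :: "'a::real_inner set \<Rightarrow> 'a \<Rightarrow> 'a \<Rightarrow> bool" where
  "outer_unit_normal S p n \<longleftrightarrow>
     norm n = 1 \<and>
     ((\<lambda>y. ((y - p) \<bullet> n) / norm (y - p)) \<longlongrightarrow> 0) (at p within frontier S) \<and>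
     (\<forall>\<^sub>F t in at_right 0. p + t *\<^sub>R n \<notin> closure S \<and> p - t *\<^sub>R n \<in> S)"

text \<open>On the boundary of \<open>S\<close>, the gradient is the value of its continuous extension from \<open>S\<close>.\<close>

definition normal_derivative ::
  "(real^'n::finite) set \<Rightarrow> (real^'n \<Rightarrow> real^'n) \<Rightarrow> (real^'n \<Rightarrow> real) \<Rightarrow> real^'n \<Rightarrow> real" where
  "normal_derivative S \<nu> f x = Lim (at x within S) (grad f) \<bullet> \<nu> x"

end

theory Submission
  imports Defs
begin

text \<open>The function \<open>h x = u x + (norm x)\<^sup>2 / (2 * N)\<close> is harmonic, equals \<open>(norm x)\<^sup>2 / (2 * N)\<close> on the
  boundary, and so attains its maximum at a farthest boundary point \<open>q\<close> and its minimum at a nearest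
  one \<open>p\<close>. Its outer normal derivative at \<open>q\<close> is nonnegative, which forces \<open>c \<le> 1 / N\<close>; hence the
  one at \<open>p\<close>, which is \<open>norm p * (1 / N - c)\<close> because the normal there is \<open>p / norm p\<close>, is nonnegative
  too. By Hopf's lemma in the ball about the origin through \<open>p\<close>, which lies inside the domain, \<open>h\<close>
  then attains its minimum in the interior. So \<open>h\<close> is constant, and the boundary lies on a sphere.\<close>

section \<open>Calculus of Laplacians built from derivatives along the coordinate axes\<close>

text \<open>Unlike \<^const>\<open>laplacian\<close>, whose partial derivatives have junk values where \<open>f\<close> is not
  differentiable, this relation is closed under linear combinations without side conditions.\<close>

definition has_laplacian_on :: "(real^'n::finite) set \<Rightarrow> (real^'n \<Rightarrow> real) \<Rightarrow> (real^'n \<Rightarrow> real) \<Rightarrow> bool" where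
  "has_laplacian_on S f L \<longleftrightarrow> (\<exists>f' f''.
     (\<forall>x\<in>S. \<forall>i. ((\<lambda>t. f (x + t *\<^sub>R axis i 1)) has_real_derivative f' i x) (at 0)) \<and>
     (\<forall>x\<in>S. \<forall>i. ((\<lambda>t. f' i (x + t *\<^sub>R axis i 1)) has_real_derivative f'' i x) (at 0)) \<and>
     (\<forall>x\<in>S. L x = (\<Sum>i\<in>UNIV. f'' i x)))"

lemma has_laplacian_onI:
  assumes "\<And>x i. x \<in> S \<Longrightarrow> ((\<lambda>t. f (x + t *\<^sub>R axis i 1)) has_real_derivative f' i x) (at 0)"
    and "\<And>x i. x \<in> S \<Longrightarrow> ((\<lambda>t. f' i (x + t *\<^sub>R axis i 1)) has_real_derivative f'' i x) (at 0)"
    and "\<And>x. x \<in> S \<Longrightarrow> L x = (\<Sum>i\<in>UNIV. f'' i x)"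
  shows "has_laplacian_on S f L"
  unfolding has_laplacian_on_def
  by (intro exI[of _ f'] exI[of _ f''] conjI ballI allI) (simp_all add: assms)

lemma has_laplacian_onE:
  assumes "has_laplacian_on S f L"
  obtains f' f'' where
    "\<And>x i. x \<in> S \<Longrightarrow> ((\<lambda>t. f (x + t *\<^sub>R axis i 1)) has_real_derivative f' i x) (at 0)"
    "\<And>x i. x \<in> S \<Longrightarrow> ((\<lambda>t. f' i (x + t *\<^sub>R axis i 1)) has_real_derivative f'' i x) (at 0)"
    "\<And>x. x \<in> S \<Longrightarrow> L x = (\<Sum>i\<in>UNIV. f'' i x)"
proof -
  from assms obtain f' f'' where
    *: "(\<forall>x\<in>S. \<forall>i. ((\<lambda>t. f (x + t *\<^sub>R axis i 1)) has_real_derivative f' i x) (at 0)) \<and>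
     (\<forall>x\<in>S. \<forall>i. ((\<lambda>t. f' i (x + t *\<^sub>R axis i 1)) has_real_derivative f'' i x) (at 0)) \<and>
     (\<forall>x\<in>S. L x = (\<Sum>i\<in>UNIV. f'' i x))"
    unfolding has_laplacian_on_def by (elim exE)
  show thesis
    by (rule that[of f' f'']) (simp_all add: *)
qed

lemma has_laplacian_on_subset:
  assumes "has_laplacian_on S f L" "T \<subseteq> S"
  shows "has_laplacian_on T f L"
proof -
  from assms(1) obtain f' f'' where
    "\<And>x i. x \<in> S \<Longrightarrow> ((\<lambda>t. f (x + t *\<^sub>R axis i 1)) has_real_derivative f' i x) (at 0)"
    "\<And>x i. x \<in> S \<Longrightarrow> ((\<lambda>t. f' i (x + t *\<^sub>R axis i 1)) has_real_derivative f'' i x) (at 0)"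
    "\<And>x. x \<in> S \<Longrightarrow> L x = (\<Sum>i\<in>UNIV. f'' i x)"
    by (erule has_laplacian_onE)
  with \<open>T \<subseteq> S\<close> show ?thesis
    by (intro has_laplacian_onI[where f' = f' and f'' = f'']) (simp_all add: subset_eq)
qed

lemma has_laplacian_on_add:
  assumes "has_laplacian_on S f L" "has_laplacian_on S g M"
  shows "has_laplacian_on S (\<lambda>x. f x + g x) (\<lambda>x. L x + M x)"
proof -
  from assms(1) obtain f' f'' where
    "\<And>x i. x \<in> S \<Longrightarrow> ((\<lambda>t. f (x + t *\<^sub>R axis i 1)) has_real_derivative f' i x) (at 0)"
    "\<And>x i. x \<in> S \<Longrightarrow> ((\<lambda>t. f' i (x + t *\<^sub>R axis i 1)) has_real_derivative f'' i x) (at 0)"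
    "\<And>x. x \<in> S \<Longrightarrow> L x = (\<Sum>i\<in>UNIV. f'' i x)"
    by (erule has_laplacian_onE)
  moreover from assms(2) obtain g' g'' where
    "\<And>x i. x \<in> S \<Longrightarrow> ((\<lambda>t. g (x + t *\<^sub>R axis i 1)) has_real_derivative g' i x) (at 0)"
    "\<And>x i. x \<in> S \<Longrightarrow> ((\<lambda>t. g' i (x + t *\<^sub>R axis i 1)) has_real_derivative g'' i x) (at 0)"
    "\<And>x. x \<in> S \<Longrightarrow> M x = (\<Sum>i\<in>UNIV. g'' i x)"
    by (erule has_laplacian_onE)
  ultimately show ?thesis
    by (intro has_laplacian_onI[where f' = "\<lambda>i x. f' i x + g' i x" and f'' = "\<lambda>i x. f'' i x + g'' i x"]
        DERIV_add) (simp_all add: sum.distrib)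
qed

lemma has_laplacian_on_cmult:
  assumes "has_laplacian_on S f L"
  shows "has_laplacian_on S (\<lambda>x. k * f x) (\<lambda>x. k * L x)"
proof -
  from assms obtain f' f'' where
    "\<And>x i. x \<in> S \<Longrightarrow> ((\<lambda>t. f (x + t *\<^sub>R axis i 1)) has_real_derivative f' i x) (at 0)"
    "\<And>x i. x \<in> S \<Longrightarrow> ((\<lambda>t. f' i (x + t *\<^sub>R axis i 1)) has_real_derivative f'' i x) (at 0)"
    "\<And>x. x \<in> S \<Longrightarrow> L x = (\<Sum>i\<in>UNIV. f'' i x)"
    by (erule has_laplacian_onE)
  then show ?thesis
    by (intro has_laplacian_onI[where f' = "\<lambda>i x. k * f' i x" and f'' = "\<lambda>i x. k * f'' i x"]
        DERIV_cmult) (simp_all add: sum_distrib_left)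
qed

lemma DERIV_norm_sq_axis:
  fixes x y :: "real^'n::finite"
  shows "((\<lambda>t. (norm (x + t *\<^sub>R axis i 1 - y))\<^sup>2) has_real_derivative 2 * (x - y) $ i) (at 0)"
proof -
  have *: "(norm (x + t *\<^sub>R axis i 1 - y))\<^sup>2 = (norm (x - y))\<^sup>2 + 2 * t * (x - y) $ i + t\<^sup>2" for t :: real
    unfolding power2_norm_eq_inner
    by (simp add: inner_axis inner_commute algebra_simps power2_eq_square)
  show ?thesis unfolding * by (auto intro!: derivative_eq_intros)
qed

lemma DERIV_component_axis:
  fixes x y :: "real^'n::finite"
  shows "((\<lambda>t. (x + t *\<^sub>R axis i 1 - y) $ i) has_real_derivative 1) (at 0)"
  by (auto intro!: derivative_eq_intros simp: axis_def)

lemma has_laplacian_on_norm_sq: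
  fixes S :: "(real^'n::finite) set"
  shows "has_laplacian_on S (\<lambda>x. (norm x)\<^sup>2) (\<lambda>x. 2 * real CARD('n))"
proof (rule has_laplacian_onI[where f' = "\<lambda>i x. 2 * x $ i" and f'' = "\<lambda>i x. 2"])
  fix x :: "real^'n" and i
  show "((\<lambda>t. (norm (x + t *\<^sub>R axis i 1))\<^sup>2) has_real_derivative 2 * x $ i) (at 0)"
    using DERIV_norm_sq_axis[of x i 0] by simp
  show "((\<lambda>t. 2 * (x + t *\<^sub>R axis i 1) $ i) has_real_derivative 2) (at 0)"
    using DERIV_cmult[OF DERIV_component_axis[of x i 0], of 2] by simp
qed simp

text \<open>This is the barrier of Hopf's lemma. For positive \<alpha> its Laplacian is positive
  wherever \<open>2 * \<alpha> * (norm (x - y))\<^sup>2\<close> exceeds the dimension, that is, away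
  from the centre \<open>y\<close>.\<close>

lemma has_laplacian_on_gaussian:
  fixes S :: "(real^'n::finite) set"
  shows "has_laplacian_on S (\<lambda>x. exp (- \<alpha> * (norm (x - y))\<^sup>2))
    (\<lambda>x. (4 * \<alpha>\<^sup>2 * (norm (x - y))\<^sup>2 - 2 * \<alpha> * real CARD('n)) * exp (- \<alpha> * (norm (x - y))\<^sup>2))"
proof (rule has_laplacian_onI[where
      f' = "\<lambda>i x. - 2 * \<alpha> * (x - y) $ i * exp (- \<alpha> * (norm (x - y))\<^sup>2)" and
      f'' = "\<lambda>i x. (4 * \<alpha>\<^sup>2 * ((x - y) $ i)\<^sup>2 - 2 * \<alpha>) * exp (- \<alpha> * (norm (x - y))\<^sup>2)"])
  fix x :: "real^'n" and i
  have E: "((\<lambda>t. exp (- \<alpha> * (norm (x + t *\<^sub>R axis i 1 - y))\<^sup>2)) has_real_derivative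
      - 2 * \<alpha> * (x - y) $ i * exp (- \<alpha> * (norm (x - y))\<^sup>2)) (at 0)"
    by (rule DERIV_cong[OF DERIV_fun_exp[OF DERIV_cmult[OF DERIV_norm_sq_axis]]]) simp
  then show "((\<lambda>t. exp (- \<alpha> * (norm (x + t *\<^sub>R axis i 1 - y))\<^sup>2)) has_real_derivative
      - 2 * \<alpha> * (x - y) $ i * exp (- \<alpha> * (norm (x - y))\<^sup>2)) (at 0)" .
  show "((\<lambda>t. - 2 * \<alpha> * (x + t *\<^sub>R axis i 1 - y) $ i * exp (- \<alpha> * (norm (x + t *\<^sub>R axis i 1 - y))\<^sup>2))
      has_real_derivative (4 * \<alpha>\<^sup>2 * ((x - y) $ i)\<^sup>2 - 2 * \<alpha>) * exp (- \<alpha> * (norm (x - y))\<^sup>2)) (at 0)"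
    by (rule DERIV_cong[OF DERIV_mult[OF DERIV_cmult[OF DERIV_component_axis] E]])
       (simp add: power2_eq_square algebra_simps)
next
  fix x :: "real^'n"
  have "(norm (x - y))\<^sup>2 = (\<Sum>i\<in>UNIV. ((x - y) $ i)\<^sup>2)"
    unfolding power2_norm_eq_inner by (simp add: inner_vec_def power2_eq_square)
  then show "(4 * \<alpha>\<^sup>2 * (norm (x - y))\<^sup>2 - 2 * \<alpha> * real CARD('n)) * exp (- \<alpha> * (norm (x - y))\<^sup>2) =
      (\<Sum>i\<in>UNIV. (4 * \<alpha>\<^sup>2 * ((x - y) $ i)\<^sup>2 - 2 * \<alpha>) * exp (- \<alpha> * (norm (x - y))\<^sup>2))"
    by (simp add: sum_distrib_right[symmetric] sum_subtractf sum_distrib_left)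
qed

section \<open>The weak minimum principle\<close>

text \<open>If \<open>l\<close> were negative, \<open>g'\<close> would drop below
  \<open>g' 0 = 0\<close> just to the right of 0, and by the mean value theorem \<open>g\<close>
  would fall below \<open>g 0\<close> there.\<close>

lemma second_derivative_nonneg_at_min:
  fixes g :: "real \<Rightarrow> real"
  assumes "\<delta> > 0"
    and g': "\<And>t. \<bar>t\<bar> < \<delta> \<Longrightarrow> (g has_real_derivative g' t) (at t)"
    and g'': "(g' has_real_derivative l) (at 0)"
    and min: "\<And>t. \<bar>t\<bar> < \<delta> \<Longrightarrow> g 0 \<le> g t"
  shows "l \<ge> 0"
proof (rule ccontr)
  assume "\<not> l \<ge> 0"
  then obtain d where d: "d > 0" "\<And>t. 0 < t \<Longrightarrow> t < d \<Longrightarrow> g' t < g' 0"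
    using DERIV_neg_dec_right[OF g''] by auto
  have "g' 0 = 0"
    by (rule DERIV_local_min[OF g' \<open>\<delta> > 0\<close>]) (use min \<open>\<delta> > 0\<close> in auto)
  define b where "b = min d \<delta> / 2"
  have b: "0 < b" "b < d" "b < \<delta>"
    using d \<open>\<delta> > 0\<close> by (auto simp: b_def)
  have "\<exists>z>0. z < b \<and> g b - g 0 = (b - 0) * g' z"
    by (rule MVT2) (use b g' in auto)
  then obtain z where "0 < z" "z < b" "g b - g 0 = b * g' z"
    by auto
  moreover have "b * g' z < 0"
    using d(2)[of z] \<open>g' 0 = 0\<close> b \<open>0 < z\<close> \<open>z < b\<close> by (simp add: mult_pos_neg)
  ultimately show False
    using min[of b] b by simp
qed

lemma laplacian_nonneg_at_min:
  fixes S :: "(real^'n::finite) set"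
  assumes "open S" "has_laplacian_on S f L" "x \<in> S" and min: "\<And>z. z \<in> S \<Longrightarrow> f x \<le> f z"
  shows "L x \<ge> 0"
proof -
  from assms(2) obtain f' f'' where
    f': "\<And>x i. x \<in> S \<Longrightarrow> ((\<lambda>t. f (x + t *\<^sub>R axis i 1)) has_real_derivative f' i x) (at 0)" and
    f'': "\<And>x i. x \<in> S \<Longrightarrow> ((\<lambda>t. f' i (x + t *\<^sub>R axis i 1)) has_real_derivative f'' i x) (at 0)" and
    L: "\<And>x. x \<in> S \<Longrightarrow> L x = (\<Sum>i\<in>UNIV. f'' i x)"
    by (erule has_laplacian_onE)
  from \<open>open S\<close> \<open>x \<in> S\<close> obtain \<delta> where \<delta>: "\<delta> > 0" "ball x \<delta> \<subseteq> S"
    by (meson openE)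
  have inS: "x + t *\<^sub>R axis i 1 \<in> S" if "\<bar>t\<bar> < \<delta>" for t i
    using that \<delta> by (auto simp: subset_eq dist_norm)
  have "f'' i x \<ge> 0" for i
  proof (rule second_derivative_nonneg_at_min[where g = "\<lambda>t. f (x + t *\<^sub>R axis i 1)"
        and g' = "\<lambda>t. f' i (x + t *\<^sub>R axis i 1)", OF \<open>\<delta> > 0\<close> _ f''[OF \<open>x \<in> S\<close>]])
    fix t :: real assume "\<bar>t\<bar> < \<delta>"
    \<comment> \<open>The hypothesis on \<open>f'\<close> differentiates at parameter 0 along the
      line through the shifted point; \<open>DERIV_shift\<close> turns this into the derivative at
      parameter \<open>t\<close> along the line through \<open>x\<close>.\<close>
    have "((\<lambda>s. f (x + (s + t) *\<^sub>R axis i 1)) has_real_derivative f' i (x + t *\<^sub>R axis i 1)) (at 0)"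
      using f'[OF inS[OF \<open>\<bar>t\<bar> < \<delta>\<close>], of i] by (simp add: algebra_simps)
    then show "((\<lambda>t. f (x + t *\<^sub>R axis i 1)) has_real_derivative f' i (x + t *\<^sub>R axis i 1)) (at t)"
      using DERIV_shift[of "\<lambda>t. f (x + t *\<^sub>R axis i 1)" _ 0 t] by simp
    show "f (x + 0 *\<^sub>R axis i 1) \<le> f (x + t *\<^sub>R axis i 1)"
      using min inS[OF \<open>\<bar>t\<bar> < \<delta>\<close>] by simp
  qed
  then show ?thesis
    using L[OF \<open>x \<in> S\<close>] by (simp add: sum_nonneg)
qed

text \<open>The minimum over the compact closure is attained, and not in \<open>S\<close>, where it
  would force a nonnegative Laplacian. It is therefore attained on the frontier.\<close>

lemma strict_weak_minimum_principle:
  fixes S :: "(real^'n::finite) set"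
  assumes "open S" "bounded S" "continuous_on (closure S) f" "has_laplacian_on S f L"
    and neg: "\<And>x. x \<in> S \<Longrightarrow> L x < 0"
    and fr: "\<And>x. x \<in> frontier S \<Longrightarrow> f x \<ge> m"
    and "x \<in> closure S"
  shows "f x \<ge> m"
proof -
  have "compact (closure S)"
    using assms by simp
  then obtain z where z: "z \<in> closure S" "\<And>w. w \<in> closure S \<Longrightarrow> f z \<le> f w"
    using continuous_attains_inf[OF _ _ assms(3)] \<open>x \<in> closure S\<close> by (metis empty_iff)
  have "z \<notin> S"
    using laplacian_nonneg_at_min[OF \<open>open S\<close> assms(4), of z] neg[of z] z(2) closure_subset
    by (meson not_le subsetD)
  then have "z \<in> frontier S"
    using z \<open>open S\<close> by (simp add: frontier_def interior_open)
  then show ?thesis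
    using fr[of z] z(2)[OF \<open>x \<in> closure S\<close>] by linarith
qed

text \<open>Subtracting \<open>\<epsilon> * (norm x)\<^sup>2\<close> makes the Laplacian negative
  and, on a bounded set, lowers the values by at most \<open>\<epsilon> * B\<^sup>2\<close>. The
  strict version applies, and \<epsilon> is arbitrary.\<close>

lemma weak_minimum_principle:
  fixes S :: "(real^'n::finite) set"
  assumes "open S" "bounded S" "continuous_on (closure S) f" "has_laplacian_on S f (\<lambda>x. 0)"
    and fr: "\<And>x. x \<in> frontier S \<Longrightarrow> f x \<ge> m"
    and "x \<in> closure S"
  shows "f x \<ge> m"
proof -
  obtain B where B: "B > 0" "\<And>z. z \<in> closure S \<Longrightarrow> norm z \<le> B"
    using bounded_closure[OF \<open>bounded S\<close>] bounded_pos by metis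
  have *: "f x + \<epsilon> * B\<^sup>2 \<ge> m" if "\<epsilon> > 0" for \<epsilon>
  proof -
    have le: "\<epsilon> * (norm z)\<^sup>2 \<le> \<epsilon> * B\<^sup>2" if "z \<in> closure S" for z
      using B(2)[OF that] \<open>\<epsilon> > 0\<close> by (simp add: power_mono)
    have "f x + (- \<epsilon>) * (norm x)\<^sup>2 \<ge> m - \<epsilon> * B\<^sup>2"
    proof (rule strict_weak_minimum_principle[OF \<open>open S\<close> \<open>bounded S\<close> _
          has_laplacian_on_add[OF assms(4) has_laplacian_on_cmult[OF has_laplacian_on_norm_sq]]
          _ _ \<open>x \<in> closure S\<close>])
      show "continuous_on (closure S) (\<lambda>x. f x + (- \<epsilon>) * (norm x)\<^sup>2)"
        by (intro continuous_intros assms)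
      show "m - \<epsilon> * B\<^sup>2 \<le> f z + (- \<epsilon>) * (norm z)\<^sup>2" if "z \<in> frontier S" for z
        using fr[OF that] le[of z] that by (simp add: frontier_def)
    qed (use \<open>\<epsilon> > 0\<close> in simp)
    moreover have "\<epsilon> * (norm x)\<^sup>2 \<ge> 0"
      using \<open>\<epsilon> > 0\<close> by simp
    ultimately show ?thesis by simp
  qed
  show ?thesis
  proof (rule field_le_epsilon)
    fix e :: real assume "e > 0"
    then show "m \<le> f x + e"
      using *[of "e / B\<^sup>2"] \<open>B > 0\<close> by simp
  qed
qed

section \<open>Hopf's boundary point lemma\<close>

text \<open>On an annulus, \<open>f\<close> is compared with a multiple of a Gaussian centred at
  \<open>y\<close>, whose slope along the radius at \<open>p\<close> is nonzero. The conclusion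
  speaks of linear growth and not of a derivative, so that it also serves at a frontier point of the
  set where \<open>f\<close> is differentiable.\<close>

lemma hopf_boundary_point:
  fixes y p :: "real^'n::finite"
  assumes "dist y p = \<rho>" "\<rho> > 0"
    and cont: "continuous_on (cball y \<rho>) f"
    and lap: "has_laplacian_on (ball y \<rho>) f (\<lambda>x. 0)"
    and gt: "\<And>x. x \<in> ball y \<rho> \<Longrightarrow> f x > f p"
    and ge: "\<And>x. x \<in> sphere y \<rho> \<Longrightarrow> f x \<ge> f p"
  obtains \<kappa> where "\<kappa> > 0" "\<And>t. 0 < t \<Longrightarrow> t < 1/2 \<Longrightarrow> f (p + t *\<^sub>R (y - p)) \<ge> f p + \<kappa> * t"
proof -
  define A where "A = ball y \<rho> - cball y (\<rho>/2)"
  have "open A" "bounded A"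
    by (auto simp: A_def intro: bounded_subset[OF bounded_ball])
  have clA: "closure A \<subseteq> cball y \<rho> - ball y (\<rho>/2)"
    by (rule closure_minimal) (auto simp: A_def intro: closed_Diff)
  have frA: "frontier A \<subseteq> sphere y \<rho> \<union> sphere y (\<rho>/2)"
  proof
    fix x assume "x \<in> frontier A"
    then have "x \<in> cball y \<rho> - ball y (\<rho>/2)" "x \<notin> A"
      using clA \<open>open A\<close> by (auto simp: frontier_def interior_open)
    then show "x \<in> sphere y \<rho> \<union> sphere y (\<rho>/2)"
      by (auto simp: A_def)
  qed
  \<comment> \<open>with this \<open>\<alpha>\<close> the barrier \<open>exp (- \<alpha> * (norm (x - y))\<^sup>2)\<close> is strictly subharmonic where
    \<open>norm (x - y) > \<rho>/2\<close>\<close>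
  define \<alpha> where "\<alpha> = (2 * real CARD('n) + 1) / \<rho>\<^sup>2"
  have "\<alpha> > 0" and \<alpha>: "\<alpha> * \<rho>\<^sup>2 = 2 * real CARD('n) + 1"
    using \<open>\<rho> > 0\<close> by (simp_all add: \<alpha>_def add_nonneg_pos)
  have in_sub: "sphere y (\<rho>/2) \<subseteq> ball y \<rho>"
    using \<open>\<rho> > 0\<close> by auto
  have "sphere y (\<rho>/2) \<noteq> {}"
    using \<open>\<rho> > 0\<close> by simp
  moreover have "continuous_on (sphere y (\<rho>/2)) f"
    using in_sub ball_subset_cball by (blast intro: continuous_on_subset[OF cont])
  ultimately obtain z where z: "z \<in> sphere y (\<rho>/2)" "\<And>x. x \<in> sphere y (\<rho>/2) \<Longrightarrow> f z \<le> f x"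
    using continuous_attains_inf[OF compact_sphere] by blast
  \<comment> \<open>Compactness of the inner sphere turns the pointwise strict inequality into a
    uniform gap \<eta>, which becomes the coefficient of the barrier.\<close>
  define \<eta> where "\<eta> = f z - f p"
  have "\<eta> > 0"
    using gt[of z] z in_sub by (auto simp: \<eta>_def)
  \<comment> \<open>The constant value of the Gaussian on the outer sphere, in particular at
    \<open>p\<close>.\<close>
  define e0 where "e0 = exp (- \<alpha> * \<rho>\<^sup>2)"
  have "e0 > 0" by (simp add: e0_def)
  have barrier: "f x + (- \<eta>) * exp (- \<alpha> * (norm (x - y))\<^sup>2) \<ge> f p - \<eta> * e0" if "x \<in> closure A" for x
  proof (rule strict_weak_minimum_principle[OF \<open>open A\<close> \<open>bounded A\<close> _
        has_laplacian_on_add[OF _ has_laplacian_on_cmult[OF has_laplacian_on_gaussian]] _ _ that])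
    show "continuous_on (closure A) (\<lambda>x. f x + (- \<eta>) * exp (- \<alpha> * (norm (x - y))\<^sup>2))"
      by (intro continuous_intros continuous_on_subset[OF cont]) (use clA in auto)
    show "has_laplacian_on A f (\<lambda>x. 0)"
      by (rule has_laplacian_on_subset[OF lap]) (auto simp: A_def)
  next
    fix x assume "x \<in> A"
    then have "norm (x - y) > \<rho>/2"
      by (simp add: A_def dist_norm norm_minus_commute)
    then have "(norm (x - y))\<^sup>2 > (\<rho>/2)\<^sup>2"
      using \<open>\<rho> > 0\<close> by (intro power_strict_mono) auto
    \<comment> \<open>The right-hand side is \<open>\<alpha> * \<rho>\<^sup>2\<close>, which by the
      choice of \<alpha> exceeds twice the dimension by one.\<close>
    then have "4 * \<alpha> * (norm (x - y))\<^sup>2 > 4 * \<alpha> * (\<rho>/2)\<^sup>2"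
      using \<open>\<alpha> > 0\<close> by simp
    also have "4 * \<alpha> * (\<rho>/2)\<^sup>2 = \<alpha> * \<rho>\<^sup>2"
      by (simp add: power2_eq_square)
    finally have "4 * \<alpha> * (norm (x - y))\<^sup>2 - 2 * real CARD('n) > 0"
      using \<alpha> by simp
    then have "\<alpha> * (4 * \<alpha> * (norm (x - y))\<^sup>2 - 2 * real CARD('n)) > 0"
      using \<open>\<alpha> > 0\<close> by simp
    then have "4 * \<alpha>\<^sup>2 * (norm (x - y))\<^sup>2 - 2 * \<alpha> * real CARD('n) > 0"
      by (simp add: power2_eq_square algebra_simps)
    then show "0 + (- \<eta>) * ((4 * \<alpha>\<^sup>2 * (norm (x - y))\<^sup>2 - 2 * \<alpha> * real CARD('n))
        * exp (- \<alpha> * (norm (x - y))\<^sup>2)) < 0"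
      using \<open>\<eta> > 0\<close> by (simp del: diff_gt_0_iff_gt)
  next
    fix x assume "x \<in> frontier A"
    then consider "x \<in> sphere y \<rho>" | "x \<in> sphere y (\<rho>/2)"
      using frA by blast
    then show "f p - \<eta> * e0 \<le> f x + (- \<eta>) * exp (- \<alpha> * (norm (x - y))\<^sup>2)"
    proof cases
      case 1
      then show ?thesis
        using ge[OF 1] by (simp add: e0_def dist_norm norm_minus_commute)
    next
      case 2
      \<comment> \<open>On the inner sphere the gap \<eta> pays for the barrier, whose Gaussian
        factor is at most 1.\<close>
      have "exp (- \<alpha> * (norm (x - y))\<^sup>2) \<le> 1"
        using \<open>\<alpha> > 0\<close> by simp
      then have "\<eta> * exp (- \<alpha> * (norm (x - y))\<^sup>2) \<le> \<eta> * 1"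
        using \<open>\<eta> > 0\<close> by (intro mult_left_mono) auto
      moreover have "f x \<ge> f p + \<eta>"
        using z(2)[OF 2] by (simp add: \<eta>_def)
      moreover have "\<eta> * e0 > 0"
        using \<open>\<eta> > 0\<close> \<open>e0 > 0\<close> by simp
      ultimately show ?thesis by simp
    qed
  qed
  show thesis
  proof (rule that)
    \<comment> \<open>The slope comes from the Gaussian on the radius: at distance
      \<open>(1 - t) * \<rho>\<close> from \<open>y\<close> it is
      \<open>e0 * exp (\<alpha> * \<rho>\<^sup>2 * (2 * t - t\<^sup>2))\<close>. Bounding
      \<open>2 * t - t\<^sup>2\<close> below by \<open>t\<close> and \<open>exp s\<close> by
      \<open>1 + s\<close> leaves a linear gain. The restriction \<open>t < 1/2\<close> keeps the
      point in the annulus.\<close>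
    show "\<eta> * (e0 * (\<alpha> * \<rho>\<^sup>2)) > 0"
      using \<open>\<eta> > 0\<close> \<open>e0 > 0\<close> \<open>\<alpha> > 0\<close> \<open>\<rho> > 0\<close> by simp
    fix t :: real assume t: "0 < t" "t < 1/2"
    define x where "x = p + t *\<^sub>R (y - p)"
    have "x - y = (1 - t) *\<^sub>R (p - y)"
      by (simp add: x_def algebra_simps)
    then have nx: "norm (x - y) = (1 - t) * \<rho>"
      using t assms(1) by (simp add: dist_norm norm_minus_commute)
    show "f (p + t *\<^sub>R (y - p)) \<ge> f p + \<eta> * (e0 * (\<alpha> * \<rho>\<^sup>2)) * t"
    proof -
      have "x \<in> A"
        using nx t \<open>\<rho> > 0\<close> by (simp add: A_def dist_norm norm_minus_commute)
      then have "f x \<ge> f p + \<eta> * (exp (- \<alpha> * (norm (x - y))\<^sup>2) - e0)"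
        using barrier[of x] closure_subset by (fastforce simp: algebra_simps)
      moreover have "exp (- \<alpha> * (norm (x - y))\<^sup>2) - e0 \<ge> e0 * (\<alpha> * \<rho>\<^sup>2) * t"
      proof -
        have "exp (- \<alpha> * (norm (x - y))\<^sup>2) = e0 * exp (\<alpha> * \<rho>\<^sup>2 * (2 * t - t\<^sup>2))"
          by (simp add: e0_def nx exp_add[symmetric] power2_eq_square algebra_simps)
        moreover have "\<alpha> * \<rho>\<^sup>2 * t \<le> \<alpha> * \<rho>\<^sup>2 * (2 * t - t\<^sup>2)"
          using t \<open>\<alpha> > 0\<close> by (intro mult_left_mono) (auto simp: power2_eq_square mult_left_le)
        then have "1 + \<alpha> * \<rho>\<^sup>2 * t \<le> exp (\<alpha> * \<rho>\<^sup>2 * (2 * t - t\<^sup>2))"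
          using exp_ge_add_one_self[of "\<alpha> * \<rho>\<^sup>2 * (2 * t - t\<^sup>2)"] by linarith
        then have "e0 * (1 + \<alpha> * \<rho>\<^sup>2 * t) \<le> e0 * exp (\<alpha> * \<rho>\<^sup>2 * (2 * t - t\<^sup>2))"
          using \<open>e0 > 0\<close> by (intro mult_left_mono) auto
        ultimately have "exp (- \<alpha> * (norm (x - y))\<^sup>2) \<ge> e0 * (1 + \<alpha> * \<rho>\<^sup>2 * t)"
          by simp
        then show ?thesis
          by (simp add: algebra_simps)
      qed
      ultimately show ?thesis
        using mult_left_mono[of "e0 * (\<alpha> * \<rho>\<^sup>2) * t" "exp (- \<alpha> * (norm (x - y))\<^sup>2) - e0" \<eta>]
          \<open>\<eta> > 0\<close> unfolding x_def[symmetric] mult.assoc by linarith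
    qed
  qed
qed

section \<open>The strong minimum principle\<close>

lemma has_derivative_imp_DERIV_along_line:
  fixes f :: "'a::real_normed_vector \<Rightarrow> real"
  assumes "(f has_derivative D) (at (x + s *\<^sub>R v))"
  shows "((\<lambda>t. f (x + t *\<^sub>R v)) has_real_derivative D v) (at s)"
proof -
  have "((\<lambda>t. x + t *\<^sub>R v) has_derivative (\<lambda>t. t *\<^sub>R v)) (at s)"
    by (auto intro!: derivative_eq_intros)
  from has_derivative_compose[OF this assms]
  have "((\<lambda>t. f (x + t *\<^sub>R v)) has_derivative (\<lambda>t. D (t *\<^sub>R v))) (at s)" .
  moreover have "D (t *\<^sub>R v) = D v * t" for t
    using linear_cmul[OF has_derivative_linear[OF assms]] by simp
  ultimately show ?thesis
    by (simp add: has_field_derivative_def)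
qed

text \<open>The set \<open>M\<close> of minimum points is relatively closed by continuity. It is
  also open: otherwise some ball free of minimum points touches \<open>M\<close> at a point
  \<open>p\<close> of \<open>S\<close>, where Hopf's lemma gives a positive slope although the
  derivative vanishes. Connectedness concludes.\<close>

lemma strong_minimum_principle:
  fixes S :: "(real^'n::finite) set"
  assumes "open S" "connected S" "f differentiable_on S" "has_laplacian_on S f (\<lambda>x. 0)"
    and ge: "\<And>x. x \<in> S \<Longrightarrow> f x \<ge> m"
    and "z \<in> S" "f z = m" "x \<in> S"
  shows "f x = m"
proof (rule ccontr)
  assume "f x \<noteq> m"
  have cont: "continuous_on S f"
    using assms(3) by (rule differentiable_imp_continuous_on)
  define M where "M = {x \<in> S. f x = m}"
  have "open (S - M)"
  proof -
    have "S - M = f -` {m<..} \<inter> S"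
      using ge by (force simp: M_def)
    then show ?thesis
      using cont \<open>open S\<close> by (metis continuous_on_open_vimage open_greaterThan)
  qed
  moreover have "open M"
  proof (rule openI)
    fix q assume "q \<in> M"
    then have "q \<in> S" by (simp add: M_def)
    with \<open>open S\<close> obtain \<delta> where \<delta>: "\<delta> > 0" "ball q \<delta> \<subseteq> S"
      by (meson openE)
    \<comment> \<open>Half the radius ensures that the closed ball about \<open>y\<close> through
      \<open>q\<close> still lies in \<open>S\<close>.\<close>
    have "ball q (\<delta>/2) \<subseteq> M"
    proof (rule ccontr)
      assume "\<not> ball q (\<delta>/2) \<subseteq> M"
      then obtain y where "y \<in> ball q (\<delta>/2)" "y \<notin> M"
        by blast
      then have y: "dist q y < \<delta>/2" "y \<notin> M"
        by simp_all
      \<comment> \<open>A point of \<open>K\<close> nearest to \<open>y\<close> is where the largest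
        open ball about \<open>y\<close> free of minimum points touches \<open>M\<close>; since
        \<open>q\<close> lies in \<open>K\<close>, that ball stays inside \<open>S\<close>.\<close>
      define K where "K = {w \<in> cball y (dist q y). f w = m}"
      have cb: "cball y (dist q y) \<subseteq> S"
      proof
        fix w assume "w \<in> cball y (dist q y)"
        then have "dist q w < \<delta>"
          using y dist_triangle[of q w y] by simp
        then show "w \<in> S" using \<delta> by auto
      qed
      have cK: "continuous_on (cball y (dist q y)) f"
        using cont cb continuous_on_subset by blast
      have "closed K"
        unfolding K_def using continuous_closed_preimage_constant[OF cK closed_cball] by simp
      moreover have "bounded K"
        unfolding K_def by (rule bounded_subset[OF bounded_cball]) blast
      moreover have "q \<in> K"
        using \<open>q \<in> M\<close> by (simp add: K_def M_def dist_commute)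
      ultimately obtain p where p: "p \<in> K" "\<And>w. w \<in> K \<Longrightarrow> dist y p \<le> dist y w"
        using distance_attains_inf[of K y] by (metis empty_iff)
      define \<rho> where "\<rho> = dist y p"
      have "f p = m" "\<rho> \<le> dist q y" "p \<in> S"
        using p(1) cb by (auto simp: K_def \<rho>_def)
      have "p \<noteq> y"
        using \<open>f p = m\<close> \<open>p \<in> S\<close> y(2) by (auto simp: M_def)
      then have "\<rho> > 0" by (simp add: \<rho>_def)
      have sub: "cball y \<rho> \<subseteq> cball y (dist q y)"
        using \<open>\<rho> \<le> dist q y\<close> by auto
      have gt: "f w > f p" if "w \<in> ball y \<rho>" for w
      proof -
        have "w \<in> cball y (dist q y)"
          using that sub ball_subset_cball by blast
        moreover have "w \<notin> K"
          using that p(2)[of w] by (auto simp: \<rho>_def)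
        ultimately show ?thesis
          using ge[of w] cb \<open>f p = m\<close> by (force simp: K_def)
      qed
      have lapb: "has_laplacian_on (ball y \<rho>) f (\<lambda>x. 0)"
        using sub cb by (intro has_laplacian_on_subset[OF assms(4)]) (auto simp: subset_eq)
      have geb: "f w \<ge> f p" if "w \<in> sphere y \<rho>" for w
        using that sub cb ge[of w] \<open>f p = m\<close> by (auto simp: subset_eq)
      obtain \<kappa> where \<kappa>: "\<kappa> > 0"
        "\<And>t. 0 < t \<Longrightarrow> t < 1/2 \<Longrightarrow> f (p + t *\<^sub>R (y - p)) \<ge> f p + \<kappa> * t"
        using hopf_boundary_point[OF \<rho>_def[symmetric] \<open>\<rho> > 0\<close>
            continuous_on_subset[OF cK sub] lapb gt geb] by metis
      obtain D where D: "(f has_derivative D) (at p)"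
        using assms(3) \<open>p \<in> S\<close> \<open>open S\<close>
        by (metis at_within_open differentiable_def differentiable_on_def)
      \<comment> \<open>As an interior minimum, \<open>p\<close> is a critical point, so the
        difference quotients along the radius tend to 0, while Hopf's lemma keeps them at least
        \<kappa>.\<close>
      have "D = (\<lambda>v. 0)"
        by (rule differential_zero_maxmin[OF \<open>p \<in> S\<close> \<open>open S\<close> D]) (use ge \<open>f p = m\<close> in auto)
      then have "((\<lambda>t. f (p + t *\<^sub>R (y - p))) has_real_derivative 0) (at 0)"
        using has_derivative_imp_DERIV_along_line[of f D p 0 "y - p"] D by simp
      then have "((\<lambda>t. (f (p + t *\<^sub>R (y - p)) - f p) / t) \<longlongrightarrow> 0) (at 0)"
        by (simp add: DERIV_def)
      then have "((\<lambda>t. (f (p + t *\<^sub>R (y - p)) - f p) / t) \<longlongrightarrow> 0) (at_right 0)"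
        by (rule filterlim_mono) (simp_all add: at_le)
      moreover have "\<forall>\<^sub>F t in at_right (0::real). \<kappa> \<le> (f (p + t *\<^sub>R (y - p)) - f p) / t"
        unfolding eventually_at_right_field
      proof (intro exI[of _ "1/2"] conjI allI impI)
        fix t :: real assume "0 < t" "t < 1/2"
        then show "\<kappa> \<le> (f (p + t *\<^sub>R (y - p)) - f p) / t"
          using \<kappa>(2)[of t] by (simp add: pos_le_divide_eq)
      qed simp
      ultimately have "\<kappa> \<le> 0"
        by (rule tendsto_lowerbound) simp
      with \<open>\<kappa> > 0\<close> show False by simp
    qed
    then show "\<exists>e>0. ball q e \<subseteq> M"
      using \<delta> by (intro exI[of _ "\<delta>/2"]) auto
  qed
  moreover have "z \<in> M" "x \<in> S - M" "M \<subseteq> S"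
    using assms \<open>f x \<noteq> m\<close> by (auto simp: M_def)
  ultimately show False
    using connectedD[OF \<open>connected S\<close>, of M "S - M"] by blast
qed

section \<open>The gradient and its boundary values\<close>

text \<open>\<open>partial\<close> rests on \<open>deriv\<close>, which is meaningful only where a
  derivative exists. Differentiability identifies the partial derivatives with the values of the
  derivative on the axes, and linearity does the rest.\<close>

lemma has_derivative_grad:
  fixes f :: "real^'n::finite \<Rightarrow> real"
  assumes "open S" "f differentiable_on S" "x \<in> S"
  shows "(f has_derivative (\<lambda>v. grad f x \<bullet> v)) (at x)"
proof -
  obtain D where D: "(f has_derivative D) (at x)"
    using assms by (metis at_within_open differentiable_def differentiable_on_def)
  have partial: "partial i f x = D (axis i 1)" for i
    unfolding partial_def
    by (rule DERIV_imp_deriv, rule has_derivative_imp_DERIV_along_line) (simp add: D)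
  have "D v = grad f x \<bullet> v" for v
  proof -
    have "D v = D (\<Sum>i\<in>UNIV. (v $ i) *\<^sub>R axis i 1)"
      using basis_expansion[of v] by (simp add: scalar_mult_eq_scaleR)
    also have "\<dots> = (\<Sum>i\<in>UNIV. (v $ i) *\<^sub>R D (axis i 1))"
      using has_derivative_linear[OF D] by (simp add: linear_sum linear_cmul)
    also have "\<dots> = grad f x \<bullet> v"
      by (simp add: grad_def inner_vec_def partial mult.commute)
    finally show ?thesis .
  qed
  then have "D = (\<lambda>v. grad f x \<bullet> v)" by (rule ext)
  with D show ?thesis by simp
qed

lemma DERIV_partial:
  fixes f :: "real^'n::finite \<Rightarrow> real"
  assumes "open S" "f differentiable_on S" "x \<in> S"
  shows "((\<lambda>t. f (x + t *\<^sub>R axis i 1)) has_real_derivative partial i f x) (at 0)"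
  using has_derivative_imp_DERIV_along_line[of f "\<lambda>v. grad f x \<bullet> v" x 0 "axis i 1"]
    has_derivative_grad[OF assms] by (simp add: inner_axis grad_def)

lemma C2_on_imp_has_laplacian_on:
  fixes f :: "real^'n::finite \<Rightarrow> real"
  assumes "open S" "C2_on S f" "\<And>x. x \<in> S \<Longrightarrow> laplacian f x = L x"
  shows "has_laplacian_on S f L"
proof (rule has_laplacian_onI[where f' = "\<lambda>i. partial i f" and f'' = "\<lambda>i. partial i (partial i f)"])
  fix x i assume "x \<in> S"
  then show "((\<lambda>t. f (x + t *\<^sub>R axis i 1)) has_real_derivative partial i f x) (at 0)"
    using assms by (intro DERIV_partial[of S]) (auto simp: C2_on_def)
  show "((\<lambda>t. partial i f (x + t *\<^sub>R axis i 1)) has_real_derivative partial i (partial i f) x) (at 0)"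
    using assms \<open>x \<in> S\<close> by (intro DERIV_partial[of S]) (auto simp: C2_on_def)
next
  fix x assume "x \<in> S"
  then show "L x = (\<Sum>i\<in>UNIV. partial i (partial i f) x)"
    using assms(3)[of x] by (simp add: laplacian_def)
qed

text \<open>\<open>normal_derivative\<close> uses \<open>Lim\<close>, which is informative only if a
  unique limit exists. The continuous extensions of the partial derivatives provide a limit, and it
  is unique because \<open>p\<close> is a limit point of \<open>S\<close>.\<close>

lemma tendsto_grad_frontier:
  fixes f :: "real^'n::finite \<Rightarrow> real"
  assumes "C2_on_closure S f" "p \<in> closure S" "p \<notin> S"
  shows "(grad f \<longlongrightarrow> Lim (at p within S) (grad f)) (at p within S)"
proof -
  have "\<exists>l. (partial i f \<longlongrightarrow> l) (at p within S)" for i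
  proof -
    have "extends_to_closure S (partial i f)"
      using assms(1) by (simp add: C2_on_closure_def)
    then obtain g where g: "continuous_on (closure S) g" "\<And>x. x \<in> S \<Longrightarrow> g x = partial i f x"
      by (auto simp: extends_to_closure_def)
    have "(g \<longlongrightarrow> g p) (at p within closure S)"
      using g(1) assms(2) by (simp add: continuous_on_def)
    then have "(g \<longlongrightarrow> g p) (at p within S)"
      by (rule tendsto_within_subset) (rule closure_subset)
    then have "(partial i f \<longlongrightarrow> g p) (at p within S)"
      using Lim_cong_within[of p p "g p" "g p" S S g "partial i f"] g by simp
    then show ?thesis ..
  qed
  then obtain l where "\<And>i. (partial i f \<longlongrightarrow> l i) (at p within S)"
    by metis
  then have "(grad f \<longlongrightarrow> (\<chi> i. l i)) (at p within S)"
    by (intro vec_tendstoI) (simp add: grad_def)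
  moreover have "at p within S \<noteq> bot"
    using assms(2,3) not_trivial_limit_within[of p S] by (metis Diff_empty Diff_insert0)
  ultimately show ?thesis
    by (simp add: tendsto_Lim)
qed

text \<open>At \<open>p\<close> only the limit \<open>H\<close> of the gradient is available. The
  mean value theorem on a short segment from \<open>p\<close> into \<open>S\<close> converts growth
  of \<open>f\<close> into a bound on the gradient at nearby points of \<open>S\<close>.\<close>

lemma boundary_derivative_ge:
  fixes f :: "'a::real_inner \<Rightarrow> real"
  assumes cont: "continuous_on (closure S) f"
    and der: "\<And>x. x \<in> S \<Longrightarrow> (f has_derivative (\<lambda>v. F x \<bullet> v)) (at x)"
    and lim: "(F \<longlongrightarrow> H) (at p within S)"
    and p: "p \<in> closure S" "p \<notin> S"
    and inS: "\<forall>\<^sub>F t in at_right 0. p + t *\<^sub>R d \<in> S"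
    and ge: "\<forall>\<^sub>F t in at_right 0. f (p + t *\<^sub>R d) \<ge> f p + \<kappa> * t"
  shows "H \<bullet> d \<ge> \<kappa>"
proof (rule ccontr)
  assume "\<not> H \<bullet> d \<ge> \<kappa>"
  have "filterlim (\<lambda>t. p + t *\<^sub>R d) (at p within S) (at_right 0)"
    unfolding filterlim_at
  proof
    show "((\<lambda>t. p + t *\<^sub>R d) \<longlongrightarrow> p) (at_right 0)"
      by (auto intro!: tendsto_eq_intros)
    show "\<forall>\<^sub>F t in at_right 0. p + t *\<^sub>R d \<in> S \<and> p + t *\<^sub>R d \<noteq> p"
      using inS by eventually_elim (use p in metis)
  qed
  from filterlim_compose[OF lim this]
  have "((\<lambda>t. F (p + t *\<^sub>R d) \<bullet> d) \<longlongrightarrow> H \<bullet> d) (at_right 0)"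
    by (intro tendsto_inner tendsto_const)
  then have "\<forall>\<^sub>F t in at_right 0. F (p + t *\<^sub>R d) \<bullet> d < \<kappa>"
    using \<open>\<not> H \<bullet> d \<ge> \<kappa>\<close> by (intro order_tendstoD) auto
  with inS ge have "\<forall>\<^sub>F t in at_right 0. p + t *\<^sub>R d \<in> S \<and>
      f (p + t *\<^sub>R d) \<ge> f p + \<kappa> * t \<and> F (p + t *\<^sub>R d) \<bullet> d < \<kappa>"
    by eventually_elim simp
  then obtain b where "b > 0" and b: "\<And>t. 0 < t \<Longrightarrow> t < b \<Longrightarrow> p + t *\<^sub>R d \<in> S \<and>
      f (p + t *\<^sub>R d) \<ge> f p + \<kappa> * t \<and> F (p + t *\<^sub>R d) \<bullet> d < \<kappa>"
    unfolding eventually_at_right_field by auto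
  \<comment> \<open>Halving keeps the endpoint \<open>c\<close> itself in the range where the growth
    bound holds; the mean value theorem on \<open>{0..c}\<close> contradicts that bound.\<close>
  define c where "c = b / 2"
  have c: "0 < c" "c < b" using \<open>b > 0\<close> by (auto simp: c_def)
  have "p + t *\<^sub>R d \<in> closure S" if "0 \<le> t" "t \<le> c" for t
    using that b[of t] c p closure_subset[of S] by (cases "t = 0") auto
  then have "continuous_on {0..c} (\<lambda>t. f (p + t *\<^sub>R d))"
    by (intro continuous_on_compose2[OF cont] continuous_intros) auto
  moreover have "((\<lambda>t. f (p + t *\<^sub>R d)) has_real_derivative F (p + t *\<^sub>R d) \<bullet> d) (at t)"
    if "0 < t" "t < c" for t
    using that c b[of t] by (intro has_derivative_imp_DERIV_along_line der) auto
  ultimately obtain t where t: "0 < t" "t < c"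
    "f (p + c *\<^sub>R d) - f (p + 0 *\<^sub>R d) = (c - 0) * (F (p + t *\<^sub>R d) \<bullet> d)"
    using MVT[of 0 c "\<lambda>t. f (p + t *\<^sub>R d)"] c
    by (metis DERIV_unique real_differentiable_def)
  have "c * (F (p + t *\<^sub>R d) \<bullet> d) < c * \<kappa>"
    using b[of t] t c by simp
  then have "f (p + c *\<^sub>R d) - f p < c * \<kappa>"
    using t(3) unfolding scaleR_zero_left add_0_right diff_zero by linarith
  then show False
    using b[of c] c by (simp add: mult.commute)
qed

section \<open>The outer normal where an inner ball touches the boundary\<close>

text \<open>With the boundary written as a graph over the hyperplane orthogonal to \<open>e\<close>,
  its tangent vectors at \<open>p\<close> are \<open>\<sigma> + D \<sigma> *\<^sub>R e\<close> with
  \<sigma> orthogonal to \<open>e\<close>. Both \<open>n\<close> and \<open>p - a\<close> are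
  orthogonal to all of these, hence parallel; that \<open>n\<close> points outward fixes the
  sign.\<close>

lemma outer_unit_normal_at_inner_ball:
  fixes S :: "(real^'n::finite) set"
  assumes "open S" "C2_boundary S" "p \<in> frontier S" "outer_unit_normal S p n"
    and ball: "ball a \<rho> \<subseteq> S" "dist a p = \<rho>" "\<rho> > 0"
  shows "n = (1 / \<rho>) *\<^sub>R (p - a)"
proof -
  from assms(2,3) have "\<exists>\<epsilon>>0. \<exists>e \<gamma>. norm e = 1 \<and> C2_on UNIV \<gamma> \<and>
      S \<inter> ball p \<epsilon> = {x \<in> ball p \<epsilon>. x \<bullet> e > \<gamma> (x - (x \<bullet> e) *\<^sub>R e)}"
    unfolding C2_boundary_def by (rule bspec)
  then obtain \<epsilon> e \<gamma> where "\<epsilon> > 0" "norm e = 1" "C2_on UNIV \<gamma>"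
    and gr: "S \<inter> ball p \<epsilon> = {x \<in> ball p \<epsilon>. x \<bullet> e > \<gamma> (x - (x \<bullet> e) *\<^sub>R e)}"
    by (elim exE conjE) (rule that)
  have n: "norm n = 1"
    "((\<lambda>y. ((y - p) \<bullet> n) / norm (y - p)) \<longlongrightarrow> 0) (at p within frontier S)"
    "\<forall>\<^sub>F t in at_right 0. p + t *\<^sub>R n \<notin> closure S \<and> p - t *\<^sub>R n \<in> S"
    using assms(4) by (auto simp: outer_unit_normal_def)
  define P where "P = (\<lambda>x. x - (x \<bullet> e) *\<^sub>R e)"
  have ee: "e \<bullet> e = 1"
    using \<open>norm e = 1\<close> by (simp add: norm_eq_1)
  have inS: "x \<in> S \<longleftrightarrow> x \<bullet> e > \<gamma> (P x)" if "x \<in> ball p \<epsilon>" for x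
    using gr that unfolding P_def by blast
  have p: "p \<in> closure S" "p \<notin> S"
    using \<open>p \<in> frontier S\<close> \<open>open S\<close> by (auto simp: frontier_def interior_open)
  have diff: "\<gamma> differentiable_on UNIV"
    using \<open>C2_on UNIV \<gamma>\<close> by (simp add: C2_on_def)
  then have cont: "continuous_on UNIV \<gamma>"
    by (rule differentiable_imp_continuous_on)
  obtain D where D: "(\<gamma> has_derivative D) (at (P p))"
    using diff by (meson UNIV_I differentiable_def differentiable_on_def)
  have linD: "linear D"
    using D by (rule has_derivative_linear)
  have pe: "p \<bullet> e = \<gamma> (P p)"
  proof (rule antisym)
    show "p \<bullet> e \<le> \<gamma> (P p)"
      using inS[of p] p \<open>\<epsilon> > 0\<close> by simp
    show "\<gamma> (P p) \<le> p \<bullet> e"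
    proof (rule ccontr)
      assume "\<not> \<gamma> (P p) \<le> p \<bullet> e"
      \<comment> \<open>If \<open>p\<close> lay strictly below the graph, this neighbourhood of
        \<open>p\<close> would miss \<open>S\<close>, although \<open>p\<close> is in its
        closure.\<close>
      define U where "U = ball p \<epsilon> \<inter> {x. x \<bullet> e < \<gamma> (P x)}"
      have "open U"
        unfolding U_def P_def
        by (intro open_Int open_ball open_Collect_less continuous_intros
            continuous_on_compose2[OF cont]) auto
      moreover have "p \<in> U"
        using \<open>\<not> \<gamma> (P p) \<le> p \<bullet> e\<close> \<open>\<epsilon> > 0\<close> by (simp add: U_def)
      moreover have "U \<inter> S = {}"
        using inS by (force simp: U_def)
      ultimately show False
        using p(1) open_Int_closure_eq_empty[of U S] by blast
    qed
  qed
  have key: "n \<bullet> (\<sigma> + D \<sigma> *\<^sub>R e) = 0 \<and> (p - a) \<bullet> (\<sigma> + D \<sigma> *\<^sub>R e) = 0" if "\<sigma> \<bullet> e = 0" for \<sigma>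
  proof (cases "\<sigma> = 0")
    case True
    then show ?thesis using linear_0[OF linD] by simp
  next
    case False
    define v where "v = \<sigma> + D \<sigma> *\<^sub>R e"
    define g where "g = (\<lambda>t::real. \<gamma> (P p + t *\<^sub>R \<sigma>))"
    \<comment> \<open>a curve in the boundary, with velocity \<open>v\<close> at \<open>p\<close>; both \<open>n\<close> and \<open>p - a\<close> are orthogonal to all such \<open>v\<close>\<close>
    define y where "y = (\<lambda>t. p + t *\<^sub>R \<sigma> + (g t - g 0) *\<^sub>R e)"
    have y0: "y 0 = p" by (simp add: y_def)
    have dg: "(g has_real_derivative D \<sigma>) (at 0)"
      unfolding g_def by (rule has_derivative_imp_DERIV_along_line) (simp add: D)
    have dy: "(y has_derivative (\<lambda>t. t *\<^sub>R v)) (at 0)"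
      unfolding y_def v_def
      by (rule derivative_eq_intros dg[unfolded has_field_derivative_def] refl)+
         (simp add: algebra_simps)
    have ye: "y t \<bullet> e = g t" for t
      using pe \<open>\<sigma> \<bullet> e = 0\<close> ee by (simp add: y_def g_def inner_add_left)
    have Py: "P (y t) = P p + t *\<^sub>R \<sigma>" for t
      using \<open>\<sigma> \<bullet> e = 0\<close> ee unfolding P_def y_def
      by (simp add: inner_add_left algebra_simps)
    have ylim: "(y \<longlongrightarrow> p) (at 0)"
      using has_derivative_continuous[OF dy] y0 by (simp add: continuous_within)
    then have near: "\<forall>\<^sub>F t in at 0. y t \<in> ball p \<epsilon>"
      using \<open>\<epsilon> > 0\<close> by (simp add: tendsto_iff dist_commute)
    have notS: "y t \<notin> S" if "y t \<in> ball p \<epsilon>" for t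
      using inS[OF that] by (simp add: ye Py g_def)
    have fr: "y t \<in> frontier S" if "y t \<in> ball p \<epsilon>" for t
    proof -
      have "\<exists>x\<in>S. dist x (y t) < \<eta>" if "\<eta> > 0" for \<eta>
      proof -
        \<comment> \<open>Raising a point of the graph by \<open>s\<close> in direction
          \<open>e\<close> enters \<open>S\<close>; \<open>s\<close> is small enough to stay within
          \<eta> of the point and inside the ball about \<open>p\<close>.\<close>
        define s where "s = min \<eta> (\<epsilon> - dist p (y t)) / 2"
        have s: "s > 0" "s < \<eta>" "dist p (y t) + s < \<epsilon>"
          using \<open>\<eta> > 0\<close> \<open>y t \<in> ball p \<epsilon>\<close> by (auto simp: s_def min_def field_simps)
        define x where "x = y t + s *\<^sub>R e"
        have dx: "dist (y t) x = s"
          using s \<open>norm e = 1\<close> by (simp add: x_def dist_norm)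
        then have "x \<in> ball p \<epsilon>"
          using s dist_triangle[of p x "y t"] by simp
        moreover have "x \<bullet> e = y t \<bullet> e + s" "P x = P (y t)"
          using ee by (simp_all add: x_def P_def inner_add_left algebra_simps)
        ultimately have "x \<in> S"
          using inS[of x] s by (simp add: ye Py g_def)
        then show ?thesis
          using dx s by (intro bexI[of _ x]) (simp_all add: dist_commute)
      qed
      then have "y t \<in> closure S"
        by (simp add: closure_approachable)
      then show ?thesis
        using notS[OF that] \<open>open S\<close> by (simp add: frontier_def interior_open)
    qed
    have yne: "y t \<noteq> p" if "t \<noteq> 0" for t
      using Py[of t] \<open>\<sigma> \<noteq> 0\<close> that by auto
    have "filterlim y (at p within frontier S) (at 0)"
      unfolding filterlim_at
    proof
      show "\<forall>\<^sub>F t in at 0. y t \<in> frontier S \<and> y t \<noteq> p"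
        using near eventually_neq_at_within[of 0]
        by eventually_elim (use fr yne in auto)
    qed (rule ylim)
    from filterlim_compose[OF n(2) this]
    have lim0: "((\<lambda>t. ((y t - p) \<bullet> n) / norm (y t - p)) \<longlongrightarrow> 0) (at 0)" .
    have "((\<lambda>t. (g t - g 0) / t) \<longlongrightarrow> D \<sigma>) (at 0)"
      using dg by (simp add: DERIV_def)
    then have "((\<lambda>t. \<sigma> + ((g t - g 0) / t) *\<^sub>R e) \<longlongrightarrow> v) (at 0)"
      unfolding v_def by (intro tendsto_intros)
    then have vel: "((\<lambda>t. (1 / t) *\<^sub>R (y t - p)) \<longlongrightarrow> v) (at 0)"
      by (rule Lim_transform_eventually)
         (auto simp: eventually_at_filter y_def scaleR_add_right)
    \<comment> \<open>The quotient tending to 0 is multiplied by the norm of the difference quotient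
      of \<open>y\<close>. The product is the component of that difference quotient along
      \<open>n\<close> up to the sign of \<open>t\<close>, which the absolute value removes.\<close>
    from tendsto_rabs[OF tendsto_mult[OF lim0 tendsto_norm[OF vel]]]
    have "((\<lambda>t. \<bar>((y t - p) \<bullet> n) / norm (y t - p) * norm ((1 / t) *\<^sub>R (y t - p))\<bar>) \<longlongrightarrow> 0) (at 0)"
      by (simp only: mult_zero_left abs_zero)
    moreover have "\<bar>((y t - p) \<bullet> n) / norm (y t - p) * norm ((1 / t) *\<^sub>R (y t - p))\<bar>
        = \<bar>((1 / t) *\<^sub>R (y t - p)) \<bullet> n\<bar>" for t
      by (simp add: abs_mult)
    ultimately have "((\<lambda>t. \<bar>((1 / t) *\<^sub>R (y t - p)) \<bullet> n\<bar>) \<longlongrightarrow> 0) (at 0)"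
      by (simp only:)
    moreover have "((\<lambda>t. \<bar>((1 / t) *\<^sub>R (y t - p)) \<bullet> n\<bar>) \<longlongrightarrow> \<bar>v \<bullet> n\<bar>) (at 0)"
      by (rule tendsto_rabs[OF tendsto_inner[OF vel tendsto_const]])
    ultimately have "\<bar>v \<bullet> n\<bar> = 0"
      by (intro tendsto_unique[OF at_neq_bot])
    then have "n \<bullet> v = 0"
      by (simp add: inner_commute)
    \<comment> \<open>The curve avoids \<open>S\<close> and hence the ball about \<open>a\<close>,
      so its squared distance from \<open>a\<close> is minimal at \<open>t = 0\<close>, where the
      derivative must vanish.\<close>
    define \<phi> where "\<phi> = (\<lambda>t. (y t - a) \<bullet> (y t - a))"
    have "(\<phi> has_derivative (\<lambda>t. (2 * ((p - a) \<bullet> v)) * t)) (at 0)"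
      unfolding \<phi>_def
      by (rule derivative_eq_intros dy refl)+ (simp add: y0 inner_commute fun_eq_iff)
    then have d\<phi>: "(\<phi> has_real_derivative 2 * ((p - a) \<bullet> v)) (at 0)"
      by (simp add: has_field_derivative_def)
    from near obtain d where d: "d > 0" "\<And>t. t \<noteq> 0 \<Longrightarrow> \<bar>t\<bar> < d \<Longrightarrow> y t \<in> ball p \<epsilon>"
      unfolding eventually_at by (auto simp: dist_real_def)
    have "\<phi> 0 \<le> \<phi> t" if "\<bar>t\<bar> < d" for t
    proof (cases "t = 0")
      case False
      then have "y t \<notin> ball a \<rho>"
        using d(2)[OF _ that] notS ball(1) by blast
      then have "norm (p - a) \<le> norm (y t - a)"
        using ball(2) by (simp add: dist_norm norm_minus_commute)
      then show ?thesis
        by (simp add: \<phi>_def y0 norm_le)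
    qed simp
    then have "2 * ((p - a) \<bullet> v) = 0"
      using d(1) by (intro DERIV_local_min[OF d\<phi>]) auto
    with \<open>n \<bullet> v = 0\<close> show ?thesis
      by (simp add: v_def)
  qed
  define q where "q = p - a"
  have nq: "norm q = \<rho>"
    using ball(2) by (simp add: q_def dist_norm norm_minus_commute)
  have zero: "w = 0" if "w \<bullet> e = 0" and "w \<bullet> (w + D w *\<^sub>R e) = 0" for w
    using that by (simp add: inner_add_right)
  have "q \<bullet> e \<noteq> 0"
  proof
    assume "q \<bullet> e = 0"
    then have "q = 0"
      using zero[of q] key[of q] by (simp add: q_def)
    then show False
      using nq \<open>\<rho> > 0\<close> by simp
  qed
  \<comment> \<open>This combination of \<open>n\<close> and \<open>q\<close> has no component along
    \<open>e\<close>. Like both of them it is orthogonal to every tangent vector, in particular to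
    the one above \<open>w\<close> itself, which forces \<open>w = 0\<close>.\<close>
  define w where "w = (q \<bullet> e) *\<^sub>R n - (n \<bullet> e) *\<^sub>R q"
  have "w \<bullet> e = 0"
    by (simp add: w_def inner_diff_left)
  moreover from key[OF this] have "w \<bullet> (w + D w *\<^sub>R e) = 0"
    by (simp add: w_def inner_diff_left q_def)
  ultimately have "w = 0" by (rule zero)
  define \<mu> where "\<mu> = (n \<bullet> e) / (q \<bullet> e)"
  have n_eq: "n = \<mu> *\<^sub>R q"
  proof -
    have "(q \<bullet> e) *\<^sub>R n = (q \<bullet> e) *\<^sub>R (\<mu> *\<^sub>R q)"
      using \<open>w = 0\<close> \<open>q \<bullet> e \<noteq> 0\<close> by (simp add: w_def \<mu>_def)
    then show ?thesis
      using \<open>q \<bullet> e \<noteq> 0\<close> by (simp only: scaleR_cancel_left simp_thms)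
  qed
  \<comment> \<open>Otherwise \<open>\<mu> = - 1 / \<rho>\<close>, and a short step from
    \<open>p\<close> along \<open>n\<close> leads into the ball about \<open>a\<close>,
    contradicting that \<open>n\<close> points out of the closure.\<close>
  have "\<mu> > 0"
  proof (rule ccontr)
    assume "\<not> \<mu> > 0"
    from n(3) obtain b where b: "b > 0" "\<And>t. 0 < t \<Longrightarrow> t < b \<Longrightarrow> p + t *\<^sub>R n \<notin> closure S"
      unfolding eventually_at_right_field by auto
    define t where "t = min b \<rho> / 2"
    have t: "0 < t" "t < b" "t < \<rho>"
      using b(1) \<open>\<rho> > 0\<close> by (auto simp: t_def)
    have mu: "\<bar>\<mu>\<bar> * \<rho> = 1"
      using n(1) n_eq nq by simp
    have "\<mu> < 0"
      using \<open>\<not> \<mu> > 0\<close> mu by (cases "\<mu> = 0") auto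
    have "p + t *\<^sub>R n - a = (1 + t * \<mu>) *\<^sub>R q"
      by (simp add: n_eq q_def algebra_simps)
    then have "norm (p + t *\<^sub>R n - a) = \<bar>1 + t * \<mu>\<bar> * \<rho>"
      by (simp add: nq)
    also have "\<dots> < \<rho>"
    proof -
      have "t * \<mu> < 0"
        using t \<open>\<mu> < 0\<close> by (simp add: mult_pos_neg)
      moreover have "\<rho> * \<mu> < t * \<mu>"
        using t \<open>\<mu> < 0\<close> by simp
      moreover have "\<rho> * \<mu> = - 1"
        using mu \<open>\<mu> < 0\<close> by (simp add: mult.commute)
      ultimately have "\<bar>1 + t * \<mu>\<bar> < 1" by linarith
      then show ?thesis using \<open>\<rho> > 0\<close> by simp
    qed
    finally have "p + t *\<^sub>R n \<in> S"
      using ball(1) by (auto simp: dist_norm norm_minus_commute)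
    then show False
      using b(2)[OF t(1,2)] closure_subset by blast
  qed
  moreover have "\<bar>\<mu>\<bar> * \<rho> = 1"
    using n(1) n_eq nq by simp
  ultimately have "\<mu> = 1 / \<rho>"
    using \<open>\<rho> > 0\<close> by (simp add: field_simps)
  with n_eq show ?thesis by (simp add: q_def)
qed

section \<open>Comparison at the farthest and nearest boundary points\<close>

theorem proposition1:
  fixes \<Omega> :: "(real^'n::finite) set"
    and \<nu> :: "real^'n \<Rightarrow> real^'n"
    and r :: "real^'n \<Rightarrow> real"
    and c :: real
  assumes "is_domain \<Omega>" and "bounded \<Omega>" and "C2_boundary \<Omega>" and "0 \<in> \<Omega>"
    and "\<And>x. x \<in> frontier \<Omega> \<Longrightarrow> outer_unit_normal \<Omega> x (\<nu> x)"
    and "\<And>x. r x = sqrt (\<Sum>i\<in>UNIV. (x $ i)\<^sup>2)"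
    and "\<exists>u. C2_on_closure \<Omega> u \<and>
           (\<forall>x\<in>\<Omega>. laplacian u x = - 1) \<and>
           (\<forall>x\<in>frontier \<Omega>. u x = 0) \<and>
           (\<forall>x\<in>frontier \<Omega>. normal_derivative \<Omega> \<nu> u x = - c * r x)"
  shows "\<exists>a R. R > 0 \<and> \<Omega> = ball a R"
proof -
  from assms(7) obtain u where C2: "C2_on_closure \<Omega> u"
    and lap: "\<And>x. x \<in> \<Omega> \<Longrightarrow> laplacian u x = - 1"
    and u0: "\<And>x. x \<in> frontier \<Omega> \<Longrightarrow> u x = 0"
    and nd: "\<And>x. x \<in> frontier \<Omega> \<Longrightarrow> normal_derivative \<Omega> \<nu> u x = - c * r x"
    by auto
  have "open \<Omega>" "connected \<Omega>"
    using assms(1) by (simp_all add: is_domain_def)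
  have r: "r x = norm x" for x
    using assms(6) by (simp add: norm_vec_def L2_set_def)
  have fr: "x \<in> closure \<Omega>" "x \<notin> \<Omega>" if "x \<in> frontier \<Omega>" for x
    using that \<open>open \<Omega>\<close> by (auto simp: frontier_def interior_open)
  have C2u: "C2_on \<Omega> u" and contu: "continuous_on (closure \<Omega>) u"
    using C2 by (simp_all add: C2_on_closure_def)
  have diffu: "u differentiable_on \<Omega>"
    using C2u by (simp add: C2_on_def)
  \<comment> \<open>Chosen so that \<open>k * (norm x)\<^sup>2\<close> has Laplacian 1, which makes
    \<open>h\<close> harmonic.\<close>
  define k where "k = 1 / (2 * real CARD('n))"
  have "k > 0" by (simp add: k_def)
  define h where "h = (\<lambda>x. u x + k * (norm x)\<^sup>2)"
  have conth: "continuous_on (closure \<Omega>) h"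
    unfolding h_def by (intro continuous_intros contu)
  have "has_laplacian_on \<Omega> h (\<lambda>x. - 1 + k * (2 * real CARD('n)))"
    unfolding h_def
    by (intro has_laplacian_on_add has_laplacian_on_cmult has_laplacian_on_norm_sq
        C2_on_imp_has_laplacian_on \<open>open \<Omega>\<close> C2u lap)
  then have laph: "has_laplacian_on \<Omega> h (\<lambda>x. 0)"
    by (simp add: k_def)
  have hfr: "h x = k * (norm x)\<^sup>2" if "x \<in> frontier \<Omega>" for x
    using u0[OF that] by (simp add: h_def)
  have derh: "(h has_derivative (\<lambda>v. (grad u x + (2 * k) *\<^sub>R x) \<bullet> v)) (at x)" if "x \<in> \<Omega>" for x
    unfolding h_def power2_norm_eq_inner
    by (rule derivative_eq_intros has_derivative_grad[OF \<open>open \<Omega>\<close> diffu that] refl)+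
       (simp add: fun_eq_iff inner_add_right inner_commute)
  have diffh: "h differentiable_on \<Omega>"
    using derh by (auto simp: differentiable_on_def differentiable_def intro: has_derivative_at_withinI)
  define G where "G = (\<lambda>x. Lim (at x within \<Omega>) (grad u))"
  have limh: "((\<lambda>x. grad u x + (2 * k) *\<^sub>R x) \<longlongrightarrow> G x + (2 * k) *\<^sub>R x) (at x within \<Omega>)"
    if "x \<in> frontier \<Omega>" for x
    unfolding G_def by (intro tendsto_intros tendsto_grad_frontier C2 fr that)
  have G\<nu>: "G x \<bullet> \<nu> x = - c * norm x" if "x \<in> frontier \<Omega>" for x
    using nd[OF that] by (simp add: normal_derivative_def G_def r)
  have "\<Omega> \<noteq> UNIV"
    using assms(2) not_bounded_UNIV by auto
  then have "frontier \<Omega> \<noteq> {}"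
    using assms(4) frontier_not_empty by blast
  have "compact (frontier \<Omega>)"
    using assms(2) by (rule compact_frontier_bounded)
  have contn: "continuous_on (frontier \<Omega>) norm"
    by (intro continuous_intros)
  obtain p where p: "p \<in> frontier \<Omega>" and pmin: "\<And>x. x \<in> frontier \<Omega> \<Longrightarrow> norm p \<le> norm x"
    using continuous_attains_inf[OF \<open>compact (frontier \<Omega>)\<close> \<open>frontier \<Omega> \<noteq> {}\<close> contn] by auto
  obtain q where q: "q \<in> frontier \<Omega>" and qmax: "\<And>x. x \<in> frontier \<Omega> \<Longrightarrow> norm x \<le> norm q"
    using continuous_attains_sup[OF \<open>compact (frontier \<Omega>)\<close> \<open>frontier \<Omega> \<noteq> {}\<close> contn] by auto
  have "p \<noteq> 0" "q \<noteq> 0"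
    using fr(2)[OF p] fr(2)[OF q] assms(4) by auto
  have hmax: "h x \<le> h q" if "x \<in> closure \<Omega>" for x
  proof -
    \<comment> \<open>The maximum principle is the minimum principle for the negative; the factor
      \<open>- 1\<close> has the form produced by \<open>has_laplacian_on_cmult\<close>.\<close>
    have "- 1 * h x \<ge> - 1 * h q"
    proof (rule weak_minimum_principle[OF \<open>open \<Omega>\<close> assms(2) _ _ _ that])
      show "continuous_on (closure \<Omega>) (\<lambda>x. - 1 * h x)"
        by (intro continuous_intros conth)
      show "has_laplacian_on \<Omega> (\<lambda>x. - 1 * h x) (\<lambda>x. 0)"
        using has_laplacian_on_cmult[OF laph, of "- 1"] by simp
      show "- 1 * h q \<le> - 1 * h x" if "x \<in> frontier \<Omega>" for x
        using qmax[OF that] \<open>k > 0\<close> by (simp add: hfr q that power_mono)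
    qed
    then show ?thesis by simp
  qed
  have hmin: "h p \<le> h x" if "x \<in> closure \<Omega>" for x
  proof (rule weak_minimum_principle[OF \<open>open \<Omega>\<close> assms(2) conth laph _ that])
    show "h p \<le> h x" if "x \<in> frontier \<Omega>" for x
      using pmin[OF that] \<open>k > 0\<close> by (simp add: hfr p that power_mono)
  qed
  \<comment> \<open>The outward derivative of \<open>h\<close> at its maximum point \<open>q\<close>
    is nonnegative. It equals \<open>2 * k * (q \<bullet> \<nu> q) - c * norm q\<close>, and
    Cauchy-Schwarz bounds the inner product by \<open>norm q\<close>.\<close>
  have "c \<le> 2 * k"
  proof -
    have \<nu>q: "norm (\<nu> q) = 1" "\<forall>\<^sub>F t in at_right 0. q - t *\<^sub>R \<nu> q \<in> \<Omega>"
      using assms(5)[OF q] by (auto simp: outer_unit_normal_def elim: eventually_mono)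
    have ev: "\<forall>\<^sub>F t in at_right 0. q + t *\<^sub>R (- \<nu> q) \<in> \<Omega>"
      using \<nu>q(2) by simp
    have "(- (G q + (2 * k) *\<^sub>R q)) \<bullet> (- \<nu> q) \<ge> 0"
    proof (rule boundary_derivative_ge[where f = "\<lambda>x. - h x" and p = q and S = \<Omega>
          and F = "\<lambda>x. - (grad u x + (2 * k) *\<^sub>R x)", OF _ _ _ fr[OF q] ev])
      show "continuous_on (closure \<Omega>) (\<lambda>x. - h x)"
        by (intro continuous_intros conth)
      show "((\<lambda>x. - h x) has_derivative (\<lambda>v. - (grad u x + (2 * k) *\<^sub>R x) \<bullet> v)) (at x)"
        if "x \<in> \<Omega>" for x
        using has_derivative_minus[OF derh[OF that]] by (simp only: inner_minus_left)
      show "((\<lambda>x. - (grad u x + (2 * k) *\<^sub>R x)) \<longlongrightarrow> - (G q + (2 * k) *\<^sub>R q)) (at q within \<Omega>)"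
        by (rule tendsto_minus[OF limh[OF q]])
      show "\<forall>\<^sub>F t in at_right 0. - h q + 0 * t \<le> - h (q + t *\<^sub>R (- \<nu> q))"
        using ev
      proof eventually_elim
        case (elim t)
        then show ?case
          using hmax[of "q + t *\<^sub>R (- \<nu> q)"] closure_subset[of \<Omega>] by auto
      qed
    qed
    then have "c * norm q \<le> 2 * k * (q \<bullet> \<nu> q)"
      using G\<nu>[OF q] by (simp add: inner_diff_left)
    also have "q \<bullet> \<nu> q \<le> norm q"
      using norm_cauchy_schwarz[of q "\<nu> q"] \<nu>q(1) by simp
    then have "2 * k * (q \<bullet> \<nu> q) \<le> 2 * k * norm q"
      using \<open>k > 0\<close> by simp
    finally show ?thesis
      using \<open>q \<noteq> 0\<close> by simp
  qed
  \<comment> \<open>A ball about the origin that leaves the domain meets the frontier by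
    connectedness, and here it would do so closer than the nearest point \<open>p\<close>.\<close>
  have ball: "ball 0 (norm p) \<subseteq> \<Omega>"
  proof (rule ccontr)
    assume "\<not> ball 0 (norm p) \<subseteq> \<Omega>"
    then have "ball 0 (norm p) - \<Omega> \<noteq> {}" by blast
    moreover have "0 \<in> ball 0 (norm p) \<inter> \<Omega>"
      using assms(4) \<open>p \<noteq> 0\<close> by simp
    ultimately have "ball 0 (norm p) \<inter> frontier \<Omega> \<noteq> {}"
      using connected_Int_frontier[OF connected_ball] by (metis empty_iff)
    then show False
      using pmin by fastforce
  qed
  have "\<exists>z\<in>\<Omega>. h z = h p"
  proof (rule ccontr)
    assume "\<not> (\<exists>z\<in>\<Omega>. h z = h p)"
    then have gt: "h z > h p" if "z \<in> \<Omega>" for z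
      using hmin[of z] that closure_subset[of \<Omega>] by force
    have cb: "cball 0 (norm p) \<subseteq> closure \<Omega>"
      using closure_mono[OF ball] \<open>p \<noteq> 0\<close> by simp
    obtain \<kappa> where "\<kappa> > 0"
      and \<kappa>: "\<And>t. 0 < t \<Longrightarrow> t < 1/2 \<Longrightarrow> h (p + t *\<^sub>R (0 - p)) \<ge> h p + \<kappa> * t"
    proof (rule hopf_boundary_point[of 0 p "norm p" h])
      show "continuous_on (cball 0 (norm p)) h"
        by (rule continuous_on_subset[OF conth cb])
      show "has_laplacian_on (ball 0 (norm p)) h (\<lambda>x. 0)"
        by (rule has_laplacian_on_subset[OF laph ball])
      show "h p < h x" if "x \<in> ball 0 (norm p)" for x
        using gt ball that by blast
      show "h p \<le> h x" if "x \<in> sphere 0 (norm p)" for x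
        using hmin[of x] cb that sphere_cball by blast
    qed (use \<open>p \<noteq> 0\<close> in auto)
    \<comment> \<open>Hopf's lemma makes the derivative of \<open>h\<close> at \<open>p\<close> in
      the inward direction \<open>- p\<close> at least \<kappa>, whereas it equals
      \<open>(c - 2 * k) * (norm p)\<^sup>2\<close>, which is not positive.\<close>
    have "(G p + (2 * k) *\<^sub>R p) \<bullet> (0 - p) \<ge> \<kappa>"
    proof (rule boundary_derivative_ge[OF conth derh limh[OF p] fr[OF p]])
      show "\<forall>\<^sub>F t in at_right 0. p + t *\<^sub>R (0 - p) \<in> \<Omega>"
        unfolding eventually_at_right_field
      proof (intro exI[of _ 1] conjI allI impI)
        fix t :: real assume "0 < t" "t < 1"
        have "p + t *\<^sub>R (0 - p) = (1 - t) *\<^sub>R p"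
          by (simp add: algebra_simps)
        then have "p + t *\<^sub>R (0 - p) \<in> ball 0 (norm p)"
          using \<open>0 < t\<close> \<open>t < 1\<close> \<open>p \<noteq> 0\<close> by simp
        then show "p + t *\<^sub>R (0 - p) \<in> \<Omega>"
          using ball by blast
      qed simp
      show "\<forall>\<^sub>F t in at_right 0. h p + \<kappa> * t \<le> h (p + t *\<^sub>R (0 - p))"
        unfolding eventually_at_right_field using \<kappa> by (intro exI[of _ "1/2"]) auto
    qed
    \<comment> \<open>The boundary condition only gives the component of \<open>G p\<close> along
      the normal; the inner ball touching at \<open>p\<close> shows that this normal is
      radial.\<close>
    moreover have "G p \<bullet> p = - c * (norm p)\<^sup>2"
    proof -
      have "\<nu> p = (1 / norm p) *\<^sub>R (p - 0)"
        by (rule outer_unit_normal_at_inner_ball[OF \<open>open \<Omega>\<close> assms(3) p assms(5)[OF p] ball])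
           (use \<open>p \<noteq> 0\<close> in auto)
      then have "p = norm p *\<^sub>R \<nu> p"
        using \<open>p \<noteq> 0\<close> by simp
      then have "G p \<bullet> p = norm p * (G p \<bullet> \<nu> p)"
        by (metis inner_scaleR_right)
      then show ?thesis
        using G\<nu>[OF p] by (simp add: power2_eq_square)
    qed
    ultimately have "(c - 2 * k) * (norm p)\<^sup>2 \<ge> \<kappa>"
      by (simp add: inner_add_left inner_diff_right power2_norm_eq_inner algebra_simps)
    moreover have "(c - 2 * k) * (norm p)\<^sup>2 \<le> 0"
      using \<open>c \<le> 2 * k\<close> by (simp add: mult_nonpos_nonneg)
    ultimately show False
      using \<open>\<kappa> > 0\<close> by simp
  qed
  then obtain z where z: "z \<in> \<Omega>" "h z = h p"
    by blast
  have const: "h x = h p" if "x \<in> \<Omega>" for x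
    using strong_minimum_principle[OF \<open>open \<Omega>\<close> \<open>connected \<Omega>\<close> diffh laph _ z that] hmin closure_subset
    by blast
  \<comment> \<open>Constancy passes to the closure by continuity. Comparing boundary values then
    equates the largest and the smallest distance of the frontier from the origin.\<close>
  have "h q = h p"
    by (rule continuous_constant_on_closure[OF conth const fr(1)[OF q]])
  then have "(norm q)\<^sup>2 = (norm p)\<^sup>2"
    using hfr[OF q] hfr[OF p] \<open>k > 0\<close> by simp
  then have "norm q = norm p"
    by simp
  have "\<Omega> \<subseteq> ball 0 (norm p)"
  proof
    fix x assume "x \<in> \<Omega>"
    show "x \<in> ball 0 (norm p)"
    proof (cases "x = 0")
      case False
      \<comment> \<open>The ray from \<open>x\<close> away from the origin leaves the bounded domain
        at a frontier point, which is strictly farther out than \<open>x\<close> and has norm at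
        most \<open>norm p\<close>.\<close>
      obtain d where "0 < d" "x + d *\<^sub>R x \<in> frontier \<Omega>"
        using ray_to_frontier[OF assms(2), of x x] \<open>x \<in> \<Omega>\<close> \<open>open \<Omega>\<close> False
        by (metis interior_open)
      then have "norm (x + d *\<^sub>R x) \<le> norm p"
        using qmax \<open>norm q = norm p\<close> by metis
      moreover have "x + d *\<^sub>R x = (1 + d) *\<^sub>R x"
        by (simp add: algebra_simps)
      ultimately have "(1 + d) * norm x \<le> norm p"
        using \<open>0 < d\<close> by simp
      moreover have "norm x < (1 + d) * norm x"
        using \<open>0 < d\<close> False by (simp add: distrib_right)
      ultimately show ?thesis by simp
    qed (use \<open>p \<noteq> 0\<close> in simp)
  qed
  with ball have "\<Omega> = ball 0 (norm p)" by blast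
  then show ?thesis
    using \<open>p \<noteq> 0\<close> by (intro exI[of _ 0] exI[of _ "norm p"]) simp
qed

end
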